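(* Let $u:A\rightarrow A'$ be a morphism of algebras in $\mathcal{V}$ that lifts the Boolean congruences, and let $\Omega'$ be a countable orthogonal subset of $B(Con(A'))$. Then there exists a countable orthogonal subset $\Omega$ of $B(Con(A))$ such that $u$ lifts $\Omega'$ to $\Omega$.
   Context: $\mathcal{V}$ is a congruence modular, semidegenerate variety (no nontrivial algebra has a one-element subalgebra) of finite signature, such that for every $B\in\mathcal{V}$ the set $K(B)$ of compact congruences is closed under the Freese–McKenzie commutator $[\cdot,\cdot]$. $Con(B)$ is the congruence lattice with bounds $\Delta_B,\nabla_B$; $B(Con(B))$ is the Boolean algebra of complemented elements of $Con(B)$. For a morphism $u:A\to A'$ and $\alpha\in Con(A)$, $u^{\bullet}(\alpha)$ is the congruence of $A'$ generated by $\{(u(a),u(b)):(a,b)\in\alpha\}$; $u^{\bullet}$ restricts to a Boolean morphism $B(Con(A))\to B(Con(A'))$. For $\Omega'\subseteq Con(A')$ and $\Omega\subseteq Con(A)$, $u$ lifts $\Omega'$ to $\Omega$ if $\Omega'=\{u^{\bullet}(\alpha):\alpha\in\Omega\}$; $u$ lifts the Boolean congruences if it lifts $B(Con(A'))$ to $B(Con(A))$. A subset $\Omega$ of $B(Con(A))$ is orthogonal if $\alpha\cap\beta=\Delta_A$ (equivalently $[\alpha,\beta]=\Delta_A$) for all distinct $\alpha,\beta\in\Omega$. *)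

theory Defs
  imports Main "HOL-Library.Countable_Set"
begin

datatype ('f, 'v) trm = Var 'v | Fn 'f "('f, 'v) trm list"

fun wf_trm :: "('f \<Rightarrow> nat) \<Rightarrow> ('f, 'v) trm \<Rightarrow> bool" where
  "wf_trm ar (Var v) = True"
| "wf_trm ar (Fn g ts) = (length ts = ar g \<and> (\<forall>t\<in>set ts. wf_trm ar t))"

fun eval :: "('f \<Rightarrow> 'a list \<Rightarrow> 'a) \<Rightarrow> ('v \<Rightarrow> 'a) \<Rightarrow> ('f, 'v) trm \<Rightarrow> 'a" where
  "eval I \<rho> (Var v) = \<rho> v"
| "eval I \<rho> (Fn g ts) = I g (map (eval I \<rho>) ts)"

record ('a, 'f) alg =
  univ :: "'a set"
  ops :: "'f \<Rightarrow> 'a list \<Rightarrow> 'a"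

definition algebra :: "('f \<Rightarrow> nat) \<Rightarrow> ('a, 'f) alg \<Rightarrow> bool" where
  "algebra ar A \<longleftrightarrow> univ A \<noteq> {} \<and>
     (\<forall>g xs. length xs = ar g \<and> set xs \<subseteq> univ A \<longrightarrow> ops A g xs \<in> univ A)"

text \<open>Equational class (variety, by Birkhoff's theorem) defined by a set of identities.\<close>
definition wf_ids :: "('f \<Rightarrow> nat) \<Rightarrow> (('f, nat) trm \<times> ('f, nat) trm) set \<Rightarrow> bool" where
  "wf_ids ar Sig \<longleftrightarrow> (\<forall>(s, t)\<in>Sig. wf_trm ar s \<and> wf_trm ar t)"

definition in_var :: "('f \<Rightarrow> nat) \<Rightarrow> (('f, nat) trm \<times> ('f, nat) trm) set \<Rightarrow> ('a, 'f) alg \<Rightarrow> bool" where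
  "in_var ar Sig A \<longleftrightarrow> algebra ar A \<and>
     (\<forall>(s, t)\<in>Sig. \<forall>\<rho>. range \<rho> \<subseteq> univ A \<longrightarrow> eval (ops A) \<rho> s = eval (ops A) \<rho> t)"

definition hom :: "('f \<Rightarrow> nat) \<Rightarrow> ('a \<Rightarrow> 'b) \<Rightarrow> ('a, 'f) alg \<Rightarrow> ('b, 'f) alg \<Rightarrow> bool" where
  "hom ar u A B \<longleftrightarrow> u ` univ A \<subseteq> univ B \<and>
     (\<forall>g xs. length xs = ar g \<and> set xs \<subseteq> univ A \<longrightarrow> u (ops A g xs) = ops B g (map u xs))"

definition Con :: "('f \<Rightarrow> nat) \<Rightarrow> ('a, 'f) alg \<Rightarrow> ('a \<times> 'a) set set" where
  "Con ar A = {\<theta>. equiv (univ A) \<theta> \<and>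
     (\<forall>g xs ys. length xs = ar g \<and> length ys = ar g \<and> set xs \<subseteq> univ A \<and> set ys \<subseteq> univ A \<and>
        list_all2 (\<lambda>x y. (x, y) \<in> \<theta>) xs ys \<longrightarrow> (ops A g xs, ops A g ys) \<in> \<theta>)}"

definition Delta :: "('a, 'f) alg \<Rightarrow> ('a \<times> 'a) set" where
  "Delta A = Id_on (univ A)"

definition Nabla :: "('a, 'f) alg \<Rightarrow> ('a \<times> 'a) set" where
  "Nabla A = univ A \<times> univ A"

definition Cg :: "('f \<Rightarrow> nat) \<Rightarrow> ('a, 'f) alg \<Rightarrow> ('a \<times> 'a) set \<Rightarrow> ('a \<times> 'a) set" where
  "Cg ar A X = \<Inter> {\<theta> \<in> Con ar A. X \<subseteq> \<theta>}"

definition cjoin :: "('f \<Rightarrow> nat) \<Rightarrow> ('a, 'f) alg \<Rightarrow> ('a \<times> 'a) set \<Rightarrow> ('a \<times> 'a) set \<Rightarrow> ('a \<times> 'a) set" where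
  "cjoin ar A \<alpha> \<beta> = Cg ar A (\<alpha> \<union> \<beta>)"

definition Kcomp :: "('f \<Rightarrow> nat) \<Rightarrow> ('a, 'f) alg \<Rightarrow> ('a \<times> 'a) set set" where
  "Kcomp ar A = {\<theta> \<in> Con ar A. \<forall>D \<subseteq> Con ar A. \<theta> \<subseteq> Cg ar A (\<Union> D) \<longrightarrow>
       (\<exists>D'. finite D' \<and> D' \<subseteq> D \<and> \<theta> \<subseteq> Cg ar A (\<Union> D'))}"

definition BCon :: "('f \<Rightarrow> nat) \<Rightarrow> ('a, 'f) alg \<Rightarrow> ('a \<times> 'a) set set" where
  "BCon ar A = {\<alpha> \<in> Con ar A. \<exists>\<beta> \<in> Con ar A. \<alpha> \<inter> \<beta> = Delta A \<and> cjoin ar A \<alpha> \<beta> = Nabla A}"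

text \<open>C(alpha, beta; delta): alpha centralizes beta modulo delta. Variable 0 of the term t
  gets the alpha-related elements, variables Suc i get the beta-related ones.\<close>
definition centralizes :: "('f \<Rightarrow> nat) \<Rightarrow> ('a, 'f) alg \<Rightarrow> ('a \<times> 'a) set \<Rightarrow> ('a \<times> 'a) set \<Rightarrow> ('a \<times> 'a) set \<Rightarrow> bool" where
  "centralizes ar A \<alpha> \<beta> \<delta> \<longleftrightarrow>
     (\<forall>(t :: ('f, nat) trm) a b (c :: nat \<Rightarrow> 'a) d. wf_trm ar t \<and> (a, b) \<in> \<alpha> \<and> (\<forall>i. (c i, d i) \<in> \<beta>) \<longrightarrow>
        (eval (ops A) (case_nat a c) t, eval (ops A) (case_nat a d) t) \<in> \<delta> \<longrightarrow>
        (eval (ops A) (case_nat b c) t, eval (ops A) (case_nat b d) t) \<in> \<delta>)"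

definition comm :: "('f \<Rightarrow> nat) \<Rightarrow> ('a, 'f) alg \<Rightarrow> ('a \<times> 'a) set \<Rightarrow> ('a \<times> 'a) set \<Rightarrow> ('a \<times> 'a) set" where
  "comm ar A \<alpha> \<beta> = \<Inter> {\<delta> \<in> Con ar A. centralizes ar A \<alpha> \<beta> \<delta>}"

section \<open>Standing hypotheses on the variety, for all its algebras with universe in type 'a\<close>

definition cong_modular_var :: "('f \<Rightarrow> nat) \<Rightarrow> (('f, nat) trm \<times> ('f, nat) trm) set \<Rightarrow> 'a itself \<Rightarrow> bool" where
  "cong_modular_var ar Sig T \<longleftrightarrow> (\<forall>B :: ('a, 'f) alg. in_var ar Sig B \<longrightarrow>
     (\<forall>\<alpha>\<in>Con ar B. \<forall>\<beta>\<in>Con ar B. \<forall>\<gamma>\<in>Con ar B. \<alpha> \<subseteq> \<gamma> \<longrightarrow>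
        cjoin ar B \<alpha> (\<beta> \<inter> \<gamma>) = cjoin ar B \<alpha> \<beta> \<inter> \<gamma>))"

definition semidegenerate_var :: "('f \<Rightarrow> nat) \<Rightarrow> (('f, nat) trm \<times> ('f, nat) trm) set \<Rightarrow> 'a itself \<Rightarrow> bool" where
  "semidegenerate_var ar Sig T \<longleftrightarrow> (\<forall>B :: ('a, 'f) alg. in_var ar Sig B \<longrightarrow>
     (\<exists>x y. x \<in> univ B \<and> y \<in> univ B \<and> x \<noteq> y) \<longrightarrow>
     \<not> (\<exists>x\<in>univ B. \<forall>g. ops B g (replicate (ar g) x) = x))"

definition compact_comm_closed_var :: "('f \<Rightarrow> nat) \<Rightarrow> (('f, nat) trm \<times> ('f, nat) trm) set \<Rightarrow> 'a itself \<Rightarrow> bool" where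
  "compact_comm_closed_var ar Sig T \<longleftrightarrow> (\<forall>B :: ('a, 'f) alg. in_var ar Sig B \<longrightarrow>
     (\<forall>\<alpha>\<in>Kcomp ar B. \<forall>\<beta>\<in>Kcomp ar B. comm ar B \<alpha> \<beta> \<in> Kcomp ar B))"

definition var_hyps :: "('f \<Rightarrow> nat) \<Rightarrow> (('f, nat) trm \<times> ('f, nat) trm) set \<Rightarrow> 'a itself \<Rightarrow> bool" where
  "var_hyps ar Sig T \<longleftrightarrow> cong_modular_var ar Sig T \<and> semidegenerate_var ar Sig T \<and>
     compact_comm_closed_var ar Sig T"

definition ubul :: "('f \<Rightarrow> nat) \<Rightarrow> ('a \<Rightarrow> 'b) \<Rightarrow> ('b, 'f) alg \<Rightarrow> ('a \<times> 'a) set \<Rightarrow> ('b \<times> 'b) set" where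
  "ubul ar u A' \<alpha> = Cg ar A' ((\<lambda>(a, b). (u a, u b)) ` \<alpha>)"

definition lifts :: "('f \<Rightarrow> nat) \<Rightarrow> ('a \<Rightarrow> 'b) \<Rightarrow> ('b, 'f) alg \<Rightarrow> ('b \<times> 'b) set set \<Rightarrow> ('a \<times> 'a) set set \<Rightarrow> bool" where
  "lifts ar u A' \<Omega>' \<Omega> \<longleftrightarrow> \<Omega>' = ubul ar u A' ` \<Omega>"

definition lifts_boolean :: "('f \<Rightarrow> nat) \<Rightarrow> ('a \<Rightarrow> 'b) \<Rightarrow> ('a, 'f) alg \<Rightarrow> ('b, 'f) alg \<Rightarrow> bool" where
  "lifts_boolean ar u A A' \<longleftrightarrow> lifts ar u A' (BCon ar A') (BCon ar A)"

definition orthogonal :: "('f \<Rightarrow> nat) \<Rightarrow> ('a, 'f) alg \<Rightarrow> ('a \<times> 'a) set set \<Rightarrow> bool" where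
  "orthogonal ar A \<Omega> \<longleftrightarrow> \<Omega> \<subseteq> BCon ar A \<and>
     (\<forall>\<alpha>\<in>\<Omega>. \<forall>\<beta>\<in>\<Omega>. \<alpha> \<noteq> \<beta> \<longrightarrow> \<alpha> \<inter> \<beta> = Delta A)"

end

theory Submission
  imports Defs
begin

text \<open>
  Modularity makes centrality of congruences symmetric, monotone in the modulus and compatible with
  joins; semidegeneracy makes every congruence central to \<open>\<nabla>\<close> modulo \<open>\<delta>\<close> lie below
  \<open>\<delta>\<close>, because the diagonal becomes a one-element subalgebra of a quotient. Hence
  \<open>\<gamma> = (\<gamma> \<inter> \<beta>) \<or> (\<gamma> \<inter> \<beta>')\<close> for every congruence \<open>\<gamma>\<close> and all
  complements \<open>\<beta>, \<beta>'\<close>, and complemented congruences are closed under intersection.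
  Enumerate \<open>\<Omega>'\<close>, lift each member \<open>\<omega>\<close> to some \<open>x \<omega>\<close> with complement
  \<open>x' \<omega>\<close>, and replace \<open>x \<omega>\<close> by its intersection with all \<open>x' \<eta>\<close> for earlier
  \<open>\<eta>\<close>. The part cut off, \<open>x \<omega> \<inter> x \<eta>\<close>, is mapped below
  \<open>\<omega> \<inter> \<eta> = \<Delta>\<close>, so the image is unchanged because \<open>u\<^sup>\<bullet>\<close> preserves joins.
\<close>

section \<open>Congruences\<close>

lemma ConI:
  assumes "\<theta> \<subseteq> univ A \<times> univ A"
    and "\<And>x. x \<in> univ A \<Longrightarrow> (x, x) \<in> \<theta>"
    and "\<And>x y. (x, y) \<in> \<theta> \<Longrightarrow> (y, x) \<in> \<theta>"
    and "\<And>x y z. (x, y) \<in> \<theta> \<Longrightarrow> (y, z) \<in> \<theta> \<Longrightarrow> (x, z) \<in> \<theta>"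
    and "\<And>g xs ys. length xs = ar g \<Longrightarrow> length ys = ar g \<Longrightarrow> set xs \<subseteq> univ A \<Longrightarrow> set ys \<subseteq> univ A \<Longrightarrow>
        list_all2 (\<lambda>x y. (x, y) \<in> \<theta>) xs ys \<Longrightarrow> (ops A g xs, ops A g ys) \<in> \<theta>"
  shows "\<theta> \<in> Con ar A"
proof -
  have "equiv (univ A) \<theta>"
    using assms(1-4) by (intro equivI refl_onI symI transI) blast+
  then show ?thesis
    unfolding Con_def using assms(5) by blast
qed

lemma Con_subset: "\<theta> \<in> Con ar A \<Longrightarrow> \<theta> \<subseteq> univ A \<times> univ A"
  unfolding Con_def equiv_def by blast

lemma Con_univ: "\<theta> \<in> Con ar A \<Longrightarrow> (x, y) \<in> \<theta> \<Longrightarrow> x \<in> univ A \<and> y \<in> univ A"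
  using Con_subset by blast

lemma Con_refl: "\<theta> \<in> Con ar A \<Longrightarrow> x \<in> univ A \<Longrightarrow> (x, x) \<in> \<theta>"
  unfolding Con_def equiv_def refl_on_def by blast

lemma Con_sym: "\<theta> \<in> Con ar A \<Longrightarrow> (x, y) \<in> \<theta> \<Longrightarrow> (y, x) \<in> \<theta>"
  unfolding Con_def equiv_def sym_def by blast

lemma Con_trans: "\<theta> \<in> Con ar A \<Longrightarrow> (x, y) \<in> \<theta> \<Longrightarrow> (y, z) \<in> \<theta> \<Longrightarrow> (x, z) \<in> \<theta>"
  unfolding Con_def equiv_def trans_def by blast

lemma list_all2_rel_set:
  assumes "list_all2 (\<lambda>x y. (x, y) \<in> \<theta>) xs ys" and "\<theta> \<subseteq> U \<times> U"
  shows "set xs \<subseteq> U" and "set ys \<subseteq> U"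
  using assms by (induction rule: list_all2_induct) auto

lemma Con_compat:
  assumes "\<theta> \<in> Con ar A" "length xs = ar g" "list_all2 (\<lambda>x y. (x, y) \<in> \<theta>) xs ys"
  shows "(ops A g xs, ops A g ys) \<in> \<theta>"
proof -
  have "length ys = ar g"
    using assms(2,3) by (simp add: list_all2_lengthD)
  then show ?thesis
    using assms list_all2_rel_set[OF assms(3) Con_subset[OF assms(1)]] unfolding Con_def by blast
qed

lemma Delta_Con:
  assumes "algebra ar A"
  shows "Delta A \<in> Con ar A"
proof (rule ConI)
  fix g xs ys
  assume *: "length xs = ar g" "set xs \<subseteq> univ A"
    and "list_all2 (\<lambda>x y. (x, y) \<in> Delta A) xs ys"
  then have "list_all2 (=) xs ys"
    by (auto simp: Delta_def elim!: list_all2_mono)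
  then have "xs = ys" by (simp add: list.rel_eq)
  then show "(ops A g xs, ops A g ys) \<in> Delta A"
    using * assms by (auto simp: Delta_def algebra_def)
qed (auto simp: Delta_def)

lemma Delta_least: "\<theta> \<in> Con ar A \<Longrightarrow> Delta A \<subseteq> \<theta>"
  by (auto simp: Delta_def Con_refl)

lemma Nabla_Con: "algebra ar A \<Longrightarrow> Nabla A \<in> Con ar A"
  by (rule ConI) (auto simp: Nabla_def algebra_def)

lemma Nabla_greatest: "\<theta> \<in> Con ar A \<Longrightarrow> \<theta> \<subseteq> Nabla A"
  unfolding Nabla_def by (rule Con_subset)

lemma Con_Inter:
  assumes "D \<subseteq> Con ar A" "D \<noteq> {}"
  shows "\<Inter>D \<in> Con ar A"
proof (rule ConI)
  have D: "\<theta> \<in> Con ar A" if "\<theta> \<in> D" for \<theta>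
    using assms(1) that by (rule subsetD)
  obtain \<theta> where \<theta>: "\<theta> \<in> D" using assms(2) by blast
  show "\<Inter>D \<subseteq> univ A \<times> univ A"
    using Inter_lower[OF \<theta>] Con_subset[OF D[OF \<theta>]] by (rule subset_trans)
  show "(x, x) \<in> \<Inter>D" if "x \<in> univ A" for x
    using Con_refl[OF D that] by (rule InterI)
  show "(y, x) \<in> \<Inter>D" if "(x, y) \<in> \<Inter>D" for x y
    using Con_sym[OF D InterD[OF that]] by (rule InterI)
  show "(x, z) \<in> \<Inter>D" if "(x, y) \<in> \<Inter>D" "(y, z) \<in> \<Inter>D" for x y z
    using Con_trans[OF D InterD[OF that(1)] InterD[OF that(2)]] by (rule InterI)
  fix g xs ys
  assume len: "length xs = ar g" and l: "list_all2 (\<lambda>x y. (x, y) \<in> \<Inter>D) xs ys"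
  show "(ops A g xs, ops A g ys) \<in> \<Inter>D"
  proof (rule InterI)
    fix \<theta> assume "\<theta> \<in> D"
    then have "list_all2 (\<lambda>x y. (x, y) \<in> \<theta>) xs ys"
      using l by (auto elim!: list_all2_mono)
    then show "(ops A g xs, ops A g ys) \<in> \<theta>"
      using Con_compat[OF D[OF \<open>\<theta> \<in> D\<close>] len] by blast
  qed
qed

lemma Con_Int: "\<alpha> \<in> Con ar A \<Longrightarrow> \<beta> \<in> Con ar A \<Longrightarrow> \<alpha> \<inter> \<beta> \<in> Con ar A"
  using Con_Inter[of "{\<alpha>, \<beta>}" ar A] by simp

text \<open>The inclusion puts \<open>Nabla A\<close> into the intersected family, which would
  otherwise be empty with intersection \<open>UNIV\<close>.\<close>

lemma Cg_Con: "algebra ar A \<Longrightarrow> X \<subseteq> univ A \<times> univ A \<Longrightarrow> Cg ar A X \<in> Con ar A"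
  unfolding Cg_def by (rule Con_Inter) (use Nabla_Con in \<open>auto simp: Nabla_def\<close>)

lemma Cg_upper: "X \<subseteq> Cg ar A X"
  unfolding Cg_def by blast

lemma Cg_least: "\<theta> \<in> Con ar A \<Longrightarrow> X \<subseteq> \<theta> \<Longrightarrow> Cg ar A X \<subseteq> \<theta>"
  unfolding Cg_def by blast

lemma Cg_mono: "X \<subseteq> Y \<Longrightarrow> Cg ar A X \<subseteq> Cg ar A Y"
  unfolding Cg_def by blast

lemma cjoin_Con:
  "algebra ar A \<Longrightarrow> \<alpha> \<in> Con ar A \<Longrightarrow> \<beta> \<in> Con ar A \<Longrightarrow> cjoin ar A \<alpha> \<beta> \<in> Con ar A"
  unfolding cjoin_def by (simp add: Cg_Con Con_subset)

lemma cjoin_upper: "\<alpha> \<subseteq> cjoin ar A \<alpha> \<beta>" "\<beta> \<subseteq> cjoin ar A \<alpha> \<beta>"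
  using Cg_upper[of "\<alpha> \<union> \<beta>" ar A] unfolding cjoin_def by auto

lemma cjoin_least: "\<theta> \<in> Con ar A \<Longrightarrow> \<alpha> \<subseteq> \<theta> \<Longrightarrow> \<beta> \<subseteq> \<theta> \<Longrightarrow> cjoin ar A \<alpha> \<beta> \<subseteq> \<theta>"
  unfolding cjoin_def by (rule Cg_least) auto

lemma cjoin_commute: "cjoin ar A \<alpha> \<beta> = cjoin ar A \<beta> \<alpha>"
  unfolding cjoin_def by (simp add: Un_commute)

section \<open>Joins of congruences as transitive closures of relational products\<close>

lemma trancl_Con:
  assumes sub: "T \<subseteq> univ A \<times> univ A"
    and refl: "\<And>x. x \<in> univ A \<Longrightarrow> (x, x) \<in> T"
    and sym: "\<And>x y. (x, y) \<in> T \<Longrightarrow> (y, x) \<in> T"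
    and compat: "\<And>g xs ys. length xs = ar g \<Longrightarrow> list_all2 (\<lambda>x y. (x, y) \<in> T) xs ys \<Longrightarrow>
        (ops A g xs, ops A g ys) \<in> T"
  shows "T\<^sup>+ \<in> Con ar A"
proof (rule ConI)
  show sub': "T\<^sup>+ \<subseteq> univ A \<times> univ A"
    using trancl_subset_Sigma[OF sub] .
  show "(x, x) \<in> T\<^sup>+" if "x \<in> univ A" for x
    using refl[OF that] by blast
  show "(y, x) \<in> T\<^sup>+" if "(x, y) \<in> T\<^sup>+" for x y
    using that sym_trancl[of T] sym unfolding sym_def by blast
  show "(x, z) \<in> T\<^sup>+" if "(x, y) \<in> T\<^sup>+" "(y, z) \<in> T\<^sup>+" for x y z
    using that by (rule trancl_trans)
next
  \<comment> \<open>\<open>U\<close> makes one \<open>T\<close>-step in every coordinate at once.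
    Since \<open>T\<close> is reflexive, coordinates can idle, so chains of different lengths in
    different coordinates can be run one after the other: first the head, then the tail. Each
    \<open>U\<close>-step is then carried to \<open>T\<close> by \<open>compat\<close>.\<close>
  define U where "U = {(xs, ys). list_all2 (\<lambda>x y. (x, y) \<in> T) xs ys}"
  have U_refl: "(xs, xs) \<in> U" if "set xs \<subseteq> univ A" for xs
    using that refl by (auto simp: U_def list_all2_same)
  have head: "(x # xs, y # xs) \<in> U\<^sup>+" if "(x, y) \<in> T\<^sup>+" "set xs \<subseteq> univ A" for x y xs
    using that(1)
  proof (induction rule: trancl_induct)
    case (base y)
    then show ?case using U_refl[OF that(2)] by (auto simp: U_def)
  next
    case (step y z)
    then have "(y # xs, z # xs) \<in> U" using U_refl[OF that(2)] by (auto simp: U_def)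
    with step show ?case by (meson trancl_into_trancl)
  qed
  have tail: "(y # xs, y # ys) \<in> U\<^sup>+" if "(xs, ys) \<in> U\<^sup>+" "y \<in> univ A" for y xs ys
    using that(1)
  proof (induction rule: trancl_induct)
    case (base ys)
    then show ?case using refl[OF that(2)] by (auto simp: U_def)
  next
    case (step ys zs)
    then have "(y # ys, y # zs) \<in> U" using refl[OF that(2)] by (auto simp: U_def)
    with step show ?case by (meson trancl_into_trancl)
  qed
  have lists: "(xs, ys) \<in> U\<^sup>+" if "list_all2 (\<lambda>x y. (x, y) \<in> T\<^sup>+) xs ys" for xs ys
    using that
  proof (induction rule: list_all2_induct)
    case Nil
    then show ?case by (auto simp: U_def)
  next
    case (Cons x xs y ys)
    have "set xs \<subseteq> univ A" "y \<in> univ A"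
      using Cons.hyps list_all2_rel_set[OF _ trancl_subset_Sigma[OF sub]] trancl_subset_Sigma[OF sub]
      by blast+
    then show ?case
      using head[OF Cons.hyps(1)] tail[OF Cons.IH] by (meson trancl_trans)
  qed
  fix g xs ys
  assume len: "length xs = ar g" and "list_all2 (\<lambda>x y. (x, y) \<in> T\<^sup>+) xs ys"
  then have "(xs, ys) \<in> U\<^sup>+" by (simp add: lists)
  then have "length ys = ar g \<and> (ops A g xs, ops A g ys) \<in> T\<^sup>+"
  proof (induction rule: trancl_induct)
    case (base ys)
    then show ?case using len compat by (auto simp: U_def dest: list_all2_lengthD)
  next
    case (step ys zs)
    then show ?case using compat[of ys g zs]
      by (auto simp: U_def dest: list_all2_lengthD intro: trancl_into_trancl)
  qed
  then show "(ops A g xs, ops A g ys) \<in> T\<^sup>+" ..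
qed

lemma list_all2_relcomp:
  assumes "list_all2 (\<lambda>x y. (x, y) \<in> R O S) xs ys"
  shows "\<exists>zs. list_all2 (\<lambda>x y. (x, y) \<in> R) xs zs \<and> list_all2 (\<lambda>x y. (x, y) \<in> S) zs ys"
  using assms
proof (induction rule: list_all2_induct)
  case (Cons x xs y ys)
  then obtain z zs where "(x, z) \<in> R" "(z, y) \<in> S"
    "list_all2 (\<lambda>x y. (x, y) \<in> R) xs zs" "list_all2 (\<lambda>x y. (x, y) \<in> S) zs ys"
    by blast
  then show ?case by (intro exI[of _ "z # zs"]) simp
qed simp

lemma relcomp_compat:
  assumes "\<And>g xs ys. length xs = ar g \<Longrightarrow> list_all2 (\<lambda>x y. (x, y) \<in> R) xs ys \<Longrightarrow> (ops A g xs, ops A g ys) \<in> R"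
    and "\<And>g xs ys. length xs = ar g \<Longrightarrow> list_all2 (\<lambda>x y. (x, y) \<in> S) xs ys \<Longrightarrow> (ops A g xs, ops A g ys) \<in> S"
    and "length xs = ar g" "list_all2 (\<lambda>x y. (x, y) \<in> R O S) xs ys"
  shows "(ops A g xs, ops A g ys) \<in> R O S"
proof -
  obtain zs where "list_all2 (\<lambda>x y. (x, y) \<in> R) xs zs" "list_all2 (\<lambda>x y. (x, y) \<in> S) zs ys"
    using list_all2_relcomp[OF assms(4)] by blast
  moreover from this have "length zs = ar g" using assms(3) by (simp add: list_all2_lengthD)
  ultimately show ?thesis using assms(1-3) by blast
qed

text \<open>The product \<open>\<alpha> O \<beta> O \<alpha>\<close> is reflexive, compatible and,
  being a palindrome, symmetric. Its transitive closure is thus a congruence above both factors, and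
  elements related by the join are connected by alternating chains.\<close>

lemma cjoin_subset_trancl:
  assumes \<alpha>: "\<alpha> \<in> Con ar A" and \<beta>: "\<beta> \<in> Con ar A"
  shows "cjoin ar A \<alpha> \<beta> \<subseteq> (\<alpha> O \<beta> O \<alpha>)\<^sup>+"
proof (rule cjoin_least)
  show "(\<alpha> O \<beta> O \<alpha>)\<^sup>+ \<in> Con ar A"
  proof (rule trancl_Con)
    show "\<alpha> O \<beta> O \<alpha> \<subseteq> univ A \<times> univ A"
      using Con_subset[OF \<alpha>] by blast
    show "(x, x) \<in> \<alpha> O \<beta> O \<alpha>" if "x \<in> univ A" for x
      using Con_refl[OF \<alpha> that] Con_refl[OF \<beta> that] by blast
    show "(y, x) \<in> \<alpha> O \<beta> O \<alpha>" if "(x, y) \<in> \<alpha> O \<beta> O \<alpha>" for x y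
      using that Con_sym[OF \<alpha>] Con_sym[OF \<beta>] by blast
    show "(ops A g xs, ops A g ys) \<in> \<alpha> O \<beta> O \<alpha>"
      if "length xs = ar g" "list_all2 (\<lambda>x y. (x, y) \<in> \<alpha> O \<beta> O \<alpha>) xs ys" for g xs ys
      using Con_compat[OF \<alpha>] relcomp_compat[OF Con_compat[OF \<beta>] Con_compat[OF \<alpha>]] that
      by (rule relcomp_compat)
  qed
  show "\<alpha> \<subseteq> (\<alpha> O \<beta> O \<alpha>)\<^sup>+"
  proof clarify
    fix x y assume xy: "(x, y) \<in> \<alpha>"
    then have "y \<in> univ A" using Con_univ[OF \<alpha>] by blast
    then show "(x, y) \<in> (\<alpha> O \<beta> O \<alpha>)\<^sup>+"
      using xy Con_refl[OF \<alpha>] Con_refl[OF \<beta>] by blast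
  qed
  show "\<beta> \<subseteq> (\<alpha> O \<beta> O \<alpha>)\<^sup>+"
  proof clarify
    fix x y assume xy: "(x, y) \<in> \<beta>"
    then have "x \<in> univ A" "y \<in> univ A" using Con_univ[OF \<beta>] by blast+
    then show "(x, y) \<in> (\<alpha> O \<beta> O \<alpha>)\<^sup>+"
      using xy Con_refl[OF \<alpha>] by blast
  qed
qed

section \<open>Homomorphisms and quotients\<close>

text \<open>The inverse image of \<open>\<theta>\<close>, cut down to the universe because
  \<open>h\<close> is total on its type. For \<open>\<theta> = Delta B\<close> it is the kernel of a
  homomorphism \<open>h\<close> into \<open>B\<close>.\<close>

definition pull :: "('a, 'f) alg \<Rightarrow> ('a \<Rightarrow> 'b) \<Rightarrow> ('b \<times> 'b) set \<Rightarrow> ('a \<times> 'a) set" where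
  "pull A h \<theta> = {(x, y). x \<in> univ A \<and> y \<in> univ A \<and> (h x, h y) \<in> \<theta>}"

lemma pull_Con:
  assumes h: "hom ar h A B" and \<theta>: "\<theta> \<in> Con ar B" and A: "algebra ar A"
  shows "pull A h \<theta> \<in> Con ar A"
proof (rule ConI)
  show "pull A h \<theta> \<subseteq> univ A \<times> univ A" by (auto simp: pull_def)
  show "(x, x) \<in> pull A h \<theta>" if "x \<in> univ A" for x
    using that h Con_refl[OF \<theta>] by (auto simp: pull_def hom_def)
  show "(y, x) \<in> pull A h \<theta>" if "(x, y) \<in> pull A h \<theta>" for x y
    using that Con_sym[OF \<theta>] by (auto simp: pull_def)
  show "(x, z) \<in> pull A h \<theta>" if "(x, y) \<in> pull A h \<theta>" "(y, z) \<in> pull A h \<theta>" for x y z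
    using that Con_trans[OF \<theta>] by (auto simp: pull_def)
  fix g xs ys
  assume *: "length xs = ar g" "length ys = ar g" "set xs \<subseteq> univ A" "set ys \<subseteq> univ A"
    and "list_all2 (\<lambda>x y. (x, y) \<in> pull A h \<theta>) xs ys"
  then have "list_all2 (\<lambda>x y. (x, y) \<in> \<theta>) (map h xs) (map h ys)"
    by (auto simp: pull_def list_all2_conv_all_nth)
  then have "(ops B g (map h xs), ops B g (map h ys)) \<in> \<theta>"
    using * Con_compat[OF \<theta>] by simp
  then show "(ops A g xs, ops A g ys) \<in> pull A h \<theta>"
    using * A h by (auto simp: pull_def hom_def algebra_def)
qed

lemma eval_univ:
  assumes "algebra ar A" "range \<rho> \<subseteq> univ A" "wf_trm ar t"
  shows "eval (ops A) \<rho> t \<in> univ A"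
  using assms(3)
proof (induction t)
  case (Var v)
  then show ?case using assms(2) by auto
next
  case (Fn g ts)
  then have "set (map (eval (ops A) \<rho>) ts) \<subseteq> univ A" by auto
  then show ?case using assms(1) Fn.prems unfolding algebra_def by simp
qed

lemma eval_hom:
  assumes "algebra ar A" "hom ar h A B" "range \<rho> \<subseteq> univ A" "wf_trm ar t"
  shows "h (eval (ops A) \<rho> t) = eval (ops B) (h \<circ> \<rho>) t"
  using assms(4)
proof (induction t)
  case (Fn g ts)
  then have "set (map (eval (ops A) \<rho>) ts) \<subseteq> univ A"
    using eval_univ[OF assms(1,3)] by auto
  moreover have "map h (map (eval (ops A) \<rho>) ts) = map (eval (ops B) (h \<circ> \<rho>)) ts"
    using Fn by (simp add: comp_def)
  ultimately show ?case
    using assms(2) Fn.prems unfolding hom_def by (metis eval.simps(2) length_map wf_trm.simps(2))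
qed simp

text \<open>Every assignment in \<open>B\<close> factors through \<open>A\<close> by a section
  \<open>r\<close> of \<open>h\<close>, so an identity valid in \<open>A\<close> is pushed forward
  by \<open>eval_hom\<close>.\<close>

lemma in_var_hom_image:
  assumes A: "in_var ar Sig A" and h: "hom ar h A B" and surj: "h ` univ A = univ B"
    and wf: "wf_ids ar Sig"
  shows "in_var ar Sig B"
proof -
  have algA: "algebra ar A" using A by (simp add: in_var_def)
  define r where "r = inv_into (univ A) h"
  have r: "r y \<in> univ A" "h (r y) = y" if "y \<in> univ B" for y
    using that surj by (auto simp: r_def inv_into_into f_inv_into_f)
  have "ops B g ys \<in> univ B" if "length ys = ar g" "set ys \<subseteq> univ B" for g ys
  proof -
    have "map h (map r ys) = ys" using that(2) r by (simp add: map_idI subset_iff)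
    moreover have "set (map r ys) \<subseteq> univ A" using that(2) r by auto
    ultimately have "ops B g ys = h (ops A g (map r ys))" and "ops A g (map r ys) \<in> univ A"
      using h algA that(1) unfolding hom_def algebra_def by (metis length_map)+
    then show ?thesis using surj by blast
  qed
  then have "algebra ar B"
    using algA surj unfolding algebra_def by blast
  moreover have "eval (ops B) \<rho> s = eval (ops B) \<rho> t" if "(s, t) \<in> Sig" "range \<rho> \<subseteq> univ B" for s t \<rho>
  proof -
    have \<rho>: "h \<circ> (r \<circ> \<rho>) = \<rho>" "range (r \<circ> \<rho>) \<subseteq> univ A" using that(2) r by (auto simp: fun_eq_iff subset_iff)
    have "wf_trm ar s" "wf_trm ar t" using wf that(1) by (auto simp: wf_ids_def)
    then have "eval (ops B) \<rho> s = h (eval (ops A) (r \<circ> \<rho>) s)"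
      "eval (ops B) \<rho> t = h (eval (ops A) (r \<circ> \<rho>) t)"
      using eval_hom[OF algA h \<rho>(2)] \<rho>(1) by simp_all
    moreover have "eval (ops A) (r \<circ> \<rho>) s = eval (ops A) (r \<circ> \<rho>) t"
      using A that(1) \<rho>(2) unfolding in_var_def by blast
    ultimately show ?thesis by simp
  qed
  ultimately show ?thesis unfolding in_var_def by blast
qed

text \<open>The hypotheses on the variety speak only about algebras on a fixed type. The quotient is
  therefore built on \<open>'a\<close> rather than on sets of classes: each class is coded by the
  \<open>f\<close>-image of a chosen representative. With \<open>\<theta> = Delta A\<close> this
  yields an isomorphic copy of \<open>A\<close>.\<close>

lemma quotient_in_var:
  fixes A :: "('c, 'f) alg" and f :: "'c \<Rightarrow> 'a"
  assumes A: "in_var ar Sig A" and wf: "wf_ids ar Sig" and f: "inj f" and \<theta>: "\<theta> \<in> Con ar A"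
  obtains B :: "('a, 'f) alg" and q :: "'c \<Rightarrow> 'a" where
    "in_var ar Sig B" "hom ar q A B" "q ` univ A = univ B"
    "\<And>x y. x \<in> univ A \<Longrightarrow> y \<in> univ A \<Longrightarrow> q x = q y \<longleftrightarrow> (x, y) \<in> \<theta>"
proof -
  have algA: "algebra ar A" using A by (simp add: in_var_def)
  define rep where "rep x = (SOME y. (x, y) \<in> \<theta>)" for x
  define q where "q x = f (rep x)" for x
  have rep: "(x, rep x) \<in> \<theta>" if "x \<in> univ A" for x
    unfolding rep_def using Con_refl[OF \<theta> that] by (rule someI)
  have "rep x = rep y" if "(x, y) \<in> \<theta>" for x y
  proof -
    have "(\<lambda>z. (x, z) \<in> \<theta>) = (\<lambda>z. (y, z) \<in> \<theta>)"
      using that Con_sym[OF \<theta>] Con_trans[OF \<theta>] by blast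
    then show ?thesis by (simp add: rep_def)
  qed
  then have q_eq: "q x = q y \<longleftrightarrow> (x, y) \<in> \<theta>" if "x \<in> univ A" "y \<in> univ A" for x y
    using rep[OF that(1)] rep[OF that(2)] Con_sym[OF \<theta>] Con_trans[OF \<theta>] injD[OF f]
    unfolding q_def by metis
  define r where "r = inv_into (univ A) q"
  have r: "r (q x) \<in> univ A" "(r (q x), x) \<in> \<theta>" if "x \<in> univ A" for x
  proof -
    have "q x \<in> q ` univ A" using that by blast
    then have "r (q x) \<in> univ A" "q (r (q x)) = q x"
      by (auto simp: r_def inv_into_into f_inv_into_f)
    then show "r (q x) \<in> univ A" "(r (q x), x) \<in> \<theta>" using q_eq that by blast+
  qed
  \<comment> \<open>The operations are computed on the representatives picked by \<open>r\<close>;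
    compatibility of \<open>\<theta>\<close> makes the outcome independent of that choice.\<close>
  define B :: "('a, 'f) alg" where "B = \<lparr>univ = q ` univ A, ops = \<lambda>g ys. q (ops A g (map r ys))\<rparr>"
  have h: "hom ar q A B"
    unfolding hom_def
  proof (intro conjI allI impI)
    show "q ` univ A \<subseteq> univ B" by (simp add: B_def)
    fix g xs assume *: "length xs = ar g \<and> set xs \<subseteq> univ A"
    have "list_all2 (\<lambda>x y. (x, y) \<in> \<theta>) (map r (map q xs)) xs"
      using * r by (auto simp: list_all2_conv_all_nth subset_iff)
    then have "(ops A g (map r (map q xs)), ops A g xs) \<in> \<theta>"
      using * Con_compat[OF \<theta>] by simp
    then have "q (ops A g (map r (map q xs))) = q (ops A g xs)"
      using q_eq Con_univ[OF \<theta>] by blast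
    then show "q (ops A g xs) = ops B g (map q xs)" by (simp add: B_def)
  qed
  have surj: "q ` univ A = univ B" by (simp add: B_def)
  show ?thesis
    using that[OF in_var_hom_image[OF A h surj wf] h surj] q_eq by blast
qed

lemma inverse_hom:
  assumes h: "hom ar h A B" and bij: "bij_betw h (univ A) (univ B)" and A: "algebra ar A"
  shows "hom ar (inv_into (univ A) h) B A"
proof -
  let ?r = "inv_into (univ A) h"
  have r: "?r y \<in> univ A" "h (?r y) = y" if "y \<in> univ B" for y
    using that bij by (auto simp: bij_betw_def inv_into_into f_inv_into_f)
  have "?r (ops B g ys) = ops A g (map ?r ys)" if "length ys = ar g" "set ys \<subseteq> univ B" for g ys
  proof -
    have "map h (map ?r ys) = ys" using that(2) r by (simp add: map_idI subset_iff)
    moreover have "set (map ?r ys) \<subseteq> univ A" using that(2) r by auto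
    ultimately have "ops B g ys = h (ops A g (map ?r ys))" and "ops A g (map ?r ys) \<in> univ A"
      using h A that(1) unfolding hom_def algebra_def by (metis length_map)+
    then show ?thesis using bij by (simp add: bij_betw_def)
  qed
  then show ?thesis using r unfolding hom_def by blast
qed

text \<open>An infinite cardinal equals its square. This makes room on \<open>'a\<close> for copies
  of algebras of pairs.\<close>

lemma infinite_square_inj:
  assumes "infinite (UNIV :: 'a set)"
  obtains f :: "'a \<times> 'a \<Rightarrow> 'a" where "inj f"
proof -
  have "\<exists>f :: 'a \<times> 'a \<Rightarrow> 'a. bij_betw f (UNIV \<times> UNIV) UNIV"
    using card_of_Times_same_infinite[OF assms] card_of_ordIso by blast
  then show ?thesis using that by (auto simp: bij_betw_def)
qed

section \<open>Congruences as subalgebras of the square\<close>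

definition sqalg :: "('a, 'f) alg \<Rightarrow> ('a \<times> 'a) set \<Rightarrow> ('a \<times> 'a, 'f) alg" where
  "sqalg A \<beta> = \<lparr>univ = \<beta>, ops = \<lambda>g ps. (ops A g (map fst ps), ops A g (map snd ps))\<rparr>"

lemma univ_sqalg [simp]: "univ (sqalg A \<beta>) = \<beta>"
  by (simp add: sqalg_def)

lemma ops_sqalg: "ops (sqalg A \<beta>) g ps = (ops A g (map fst ps), ops A g (map snd ps))"
  by (simp add: sqalg_def)

lemma eval_sqalg:
  "eval (ops (sqalg A \<beta>)) \<rho> t = (eval (ops A) (fst \<circ> \<rho>) t, eval (ops A) (snd \<circ> \<rho>) t)"
  by (induction t) (simp_all add: ops_sqalg comp_def cong: map_cong)

lemma sqalg_in_var:
  assumes A: "in_var ar Sig A" and \<beta>: "\<beta> \<in> Con ar A"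
  shows "in_var ar Sig (sqalg A \<beta>)"
proof -
  have algA: "algebra ar A" using A by (simp add: in_var_def)
  have "ops (sqalg A \<beta>) g ps \<in> \<beta>" if "length ps = ar g" "set ps \<subseteq> \<beta>" for g ps
  proof -
    have "list_all2 (\<lambda>x y. (x, y) \<in> \<beta>) (map fst ps) (map snd ps)"
      using that(2) nth_mem by (fastforce simp: list_all2_conv_all_nth)
    then show ?thesis using Con_compat[OF \<beta>] that(1) by (simp add: ops_sqalg)
  qed
  moreover have "\<beta> \<noteq> {}" using algA Con_refl[OF \<beta>] by (auto simp: algebra_def)
  ultimately have "algebra ar (sqalg A \<beta>)" by (simp add: algebra_def)
  moreover have "eval (ops (sqalg A \<beta>)) \<rho> s = eval (ops (sqalg A \<beta>)) \<rho> t"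
    if "(s, t) \<in> Sig" "range \<rho> \<subseteq> \<beta>" for s t \<rho>
  proof -
    have "fst (\<rho> n) \<in> univ A \<and> snd (\<rho> n) \<in> univ A" for n
      using that(2) Con_univ[OF \<beta>, of "fst (\<rho> n)" "snd (\<rho> n)"] by auto
    then have "range (fst \<circ> \<rho>) \<subseteq> univ A" "range (snd \<circ> \<rho>) \<subseteq> univ A" by auto
    then show ?thesis using A that(1) unfolding in_var_def eval_sqalg by blast
  qed
  ultimately show ?thesis unfolding in_var_def by auto
qed

lemma sqalg_hom:
  assumes "\<beta> \<in> Con ar A"
  shows "hom ar fst (sqalg A \<beta>) A" "hom ar snd (sqalg A \<beta>) A"
    and "hom ar (\<lambda>x. (x, x)) A (sqalg A \<beta>)"
  using Con_univ[OF assms] Con_refl[OF assms] by (auto simp: hom_def ops_sqalg comp_def)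

section \<open>Centrality in modular semidegenerate varieties\<close>

text \<open>Gumm's Shifting Lemma. The path \<open>p, r, s, q\<close> puts \<open>(p, q)\<close>
  into \<open>(\<theta> \<or> \<theta>0) \<inter> \<theta>1\<close> with
  \<open>\<theta> = \<theta>2 \<inter> \<theta>1\<close>. As
  \<open>\<theta> \<subseteq> \<theta>1\<close>, the modular law turns this into
  \<open>\<theta> \<or> (\<theta>0 \<inter> \<theta>1)\<close>, and both parts lie below
  \<open>\<theta>\<close>.\<close>

lemma shifting_lemma:
  fixes B :: "('a, 'f) alg"
  assumes modular: "cong_modular_var ar Sig TYPE('a)" and B: "in_var ar Sig B"
    and \<theta>0: "\<theta>0 \<in> Con ar B" and \<theta>1: "\<theta>1 \<in> Con ar B" and \<theta>2: "\<theta>2 \<in> Con ar B"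
    and le: "\<theta>0 \<inter> \<theta>1 \<subseteq> \<theta>2"
    and square: "(p, r) \<in> \<theta>0" "(q, s) \<in> \<theta>0" "(p, q) \<in> \<theta>1" "(r, s) \<in> \<theta>1"
    and "(r, s) \<in> \<theta>2"
  shows "(p, q) \<in> \<theta>2"
proof -
  let ?\<theta> = "\<theta>2 \<inter> \<theta>1"
  have alg: "algebra ar B" using B by (simp add: in_var_def)
  have \<theta>: "?\<theta> \<in> Con ar B" using \<theta>1 \<theta>2 by (simp add: Con_Int)
  have j: "cjoin ar B ?\<theta> \<theta>0 \<in> Con ar B" using cjoin_Con[OF alg \<theta> \<theta>0] .
  have "(p, r) \<in> cjoin ar B ?\<theta> \<theta>0" "(r, s) \<in> cjoin ar B ?\<theta> \<theta>0" "(s, q) \<in> cjoin ar B ?\<theta> \<theta>0"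
    using square assms(11) Con_sym[OF \<theta>0] cjoin_upper[of ?\<theta> ar B \<theta>0] cjoin_upper(2)[of \<theta>0 ar B ?\<theta>]
    by blast+
  then have "(p, q) \<in> cjoin ar B ?\<theta> \<theta>0 \<inter> \<theta>1"
    using Con_trans[OF j] square(3) by blast
  also have "cjoin ar B ?\<theta> \<theta>0 \<inter> \<theta>1 = cjoin ar B ?\<theta> (\<theta>0 \<inter> \<theta>1)"
    using modular B \<theta> \<theta>0 \<theta>1 unfolding cong_modular_var_def by blast
  also have "\<dots> \<subseteq> ?\<theta>" using \<theta> le by (intro cjoin_least) auto
  finally show ?thesis by blast
qed

text \<open>Gumm's term-free form of the centrality relation \<open>C(\<alpha>, \<beta>; \<delta>)\<close>, with \<open>\<beta>\<close> seen
  as a subalgebra of the square of \<open>A\<close>.\<close>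

definition central ::
  "('f \<Rightarrow> nat) \<Rightarrow> ('a, 'f) alg \<Rightarrow> ('a \<times> 'a) set \<Rightarrow> ('a \<times> 'a) set \<Rightarrow> ('a \<times> 'a) set \<Rightarrow> bool" where
  "central ar A \<alpha> \<beta> \<delta> \<longleftrightarrow> (\<exists>\<Psi>\<in>Con ar (sqalg A \<beta>).
     (\<forall>a b. (a, b) \<in> \<alpha> \<longrightarrow> ((a, a), (b, b)) \<in> \<Psi>) \<and>
     (\<forall>p q. (p, q) \<in> \<Psi> \<longrightarrow> p \<in> \<delta> \<longrightarrow> q \<in> \<delta>))"

lemma central_antimono: "central ar A \<alpha> \<beta> \<delta> \<Longrightarrow> \<alpha>' \<subseteq> \<alpha> \<Longrightarrow> central ar A \<alpha>' \<beta> \<delta>"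
  unfolding central_def by blast

text \<open>Modularity and semidegeneracy are given for algebras on \<open>'a\<close>;
  \<open>infinite\<close> lets them reach the congruences of \<open>A\<close> viewed as algebras of
  pairs, and the quotients of these.\<close>

locale modular_semidegenerate =
  fixes ar :: "'f \<Rightarrow> nat" and Sig :: "(('f, nat) trm \<times> ('f, nat) trm) set" and A :: "('a, 'f) alg"
  assumes infinite: "infinite (UNIV :: 'a set)"
    and wf: "wf_ids ar Sig"
    and modular: "cong_modular_var ar Sig TYPE('a)"
    and semidegenerate: "semidegenerate_var ar Sig TYPE('a)"
    and A: "in_var ar Sig A"
begin

lemma algA: "algebra ar A"
  using A by (simp add: in_var_def)

lemma alg_sqalg: "\<beta> \<in> Con ar A \<Longrightarrow> algebra ar (sqalg A \<beta>)"
  using sqalg_in_var[OF A] by (simp add: in_var_def)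

text \<open>The algebra of pairs is copied to \<open>'a\<close> as its quotient by
  \<open>Delta\<close>; the three congruences are moved to the copy \<open>B\<close> by pulling back
  along the inverse isomorphism, and \<open>shifting_lemma\<close> is applied there.\<close>

lemma shifting_sqalg:
  assumes \<beta>: "\<beta> \<in> Con ar A"
    and \<theta>: "\<theta>0 \<in> Con ar (sqalg A \<beta>)" "\<theta>1 \<in> Con ar (sqalg A \<beta>)" "\<theta>2 \<in> Con ar (sqalg A \<beta>)"
    and le: "\<theta>0 \<inter> \<theta>1 \<subseteq> \<theta>2"
    and square: "(p, r) \<in> \<theta>0" "(q, s) \<in> \<theta>0" "(p, q) \<in> \<theta>1" "(r, s) \<in> \<theta>1" "(r, s) \<in> \<theta>2"
  shows "(p, q) \<in> \<theta>2"
proof -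
  let ?P = "sqalg A \<beta>"
  obtain f :: "'a \<times> 'a \<Rightarrow> 'a" where f: "inj f"
    using infinite_square_inj[OF infinite] .
  obtain B :: "('a, 'f) alg" and h where B: "in_var ar Sig B" and h: "hom ar h ?P B"
    and surj: "h ` univ ?P = univ B"
    and h_eq: "\<And>x y. x \<in> univ ?P \<Longrightarrow> y \<in> univ ?P \<Longrightarrow> h x = h y \<longleftrightarrow> (x, y) \<in> Delta ?P"
    using quotient_in_var[OF sqalg_in_var[OF A \<beta>] wf f Delta_Con[OF alg_sqalg[OF \<beta>]]] by metis
  have bij: "bij_betw h (univ ?P) (univ B)"
    using surj h_eq unfolding bij_betw_def inj_on_def Delta_def by blast
  let ?k = "inv_into (univ ?P) h"
  have k: "hom ar ?k B ?P" using inverse_hom[OF h bij alg_sqalg[OF \<beta>]] .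
  have algB: "algebra ar B" using B by (simp add: in_var_def)
  have pull_iff: "(h x, h y) \<in> pull B ?k \<theta> \<longleftrightarrow> (x, y) \<in> \<theta>" if "x \<in> \<beta>" "y \<in> \<beta>" for x y \<theta>
  proof -
    have "?k (h x) = x" "?k (h y) = y" using that bij by (auto simp: bij_betw_def)
    then show ?thesis using that surj by (auto simp: pull_def)
  qed
  have mem: "p \<in> \<beta>" "q \<in> \<beta>" "r \<in> \<beta>" "s \<in> \<beta>"
    using square Con_univ[OF \<theta>(1)] by auto
  have "(h p, h q) \<in> pull B ?k \<theta>2"
  proof (rule shifting_lemma[OF modular B])
    show "pull B ?k \<theta>0 \<in> Con ar B" "pull B ?k \<theta>1 \<in> Con ar B" "pull B ?k \<theta>2 \<in> Con ar B"
      using pull_Con[OF k _ algB] \<theta> by blast+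
    show "pull B ?k \<theta>0 \<inter> pull B ?k \<theta>1 \<subseteq> pull B ?k \<theta>2" using le by (auto simp: pull_def)
  qed (use square pull_iff mem in blast)+
  then show ?thesis using pull_iff mem by blast
qed

text \<open>Modulo \<open>\<Psi>\<close> the element \<open>e\<close> is fixed by all operations, so
  its class is a one-element subalgebra of the quotient, which must then be trivial.\<close>

lemma semidegenerate_sqalg:
  assumes \<beta>: "\<beta> \<in> Con ar A" and \<Psi>: "\<Psi> \<in> Con ar (sqalg A \<beta>)"
    and e: "e \<in> \<beta>" "\<And>g. (ops (sqalg A \<beta>) g (replicate (ar g) e), e) \<in> \<Psi>"
    and "p \<in> \<beta>" "q \<in> \<beta>"
  shows "(p, q) \<in> \<Psi>"
proof -
  let ?P = "sqalg A \<beta>"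
  obtain f :: "'a \<times> 'a \<Rightarrow> 'a" where f: "inj f"
    using infinite_square_inj[OF infinite] .
  obtain B :: "('a, 'f) alg" and h where B: "in_var ar Sig B" and h: "hom ar h ?P B"
    and surj: "h ` univ ?P = univ B"
    and h_eq: "\<And>x y. x \<in> univ ?P \<Longrightarrow> y \<in> univ ?P \<Longrightarrow> h x = h y \<longleftrightarrow> (x, y) \<in> \<Psi>"
    using quotient_in_var[OF sqalg_in_var[OF A \<beta>] wf f \<Psi>] by metis
  have "ops B g (replicate (ar g) (h e)) = h e" for g
  proof -
    have "ops B g (replicate (ar g) (h e)) = h (ops ?P g (replicate (ar g) e))"
      using h e(1) unfolding hom_def by (simp add: set_replicate_conv_if)
    also have "\<dots> = h e" using h_eq e Con_univ[OF \<Psi>] by blast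
    finally show ?thesis .
  qed
  moreover have "h e \<in> univ B" using e(1) surj by auto
  ultimately have "x = y" if "x \<in> univ B" "y \<in> univ B" for x y
    using semidegenerate B that unfolding semidegenerate_var_def by blast
  then show ?thesis using assms(5,6) surj h_eq[of p q] by auto
qed

text \<open>The witness \<open>\<Psi>\<close> collapses the whole diagonal, a subalgebra, to a
  single class. By semidegeneracy \<open>\<Psi>\<close> is then total, so every pair of
  \<open>\<gamma>\<close> is related to a diagonal pair, which belongs to
  \<open>\<delta>\<close>.\<close>

lemma central_Nabla:
  assumes \<gamma>: "\<gamma> \<in> Con ar A" and \<delta>: "\<delta> \<in> Con ar A" and "central ar A (Nabla A) \<gamma> \<delta>"
  shows "\<gamma> \<subseteq> \<delta>"
proof clarify
  fix a b assume ab: "(a, b) \<in> \<gamma>"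
  then have a: "a \<in> univ A" using Con_univ[OF \<gamma>] by blast
  obtain \<Psi> where \<Psi>: "\<Psi> \<in> Con ar (sqalg A \<gamma>)"
    and diag: "\<And>x y. x \<in> univ A \<Longrightarrow> y \<in> univ A \<Longrightarrow> ((x, x), (y, y)) \<in> \<Psi>"
    and sat: "\<And>p q. (p, q) \<in> \<Psi> \<Longrightarrow> p \<in> \<delta> \<Longrightarrow> q \<in> \<delta>"
    using assms(3) unfolding central_def Nabla_def by blast
  have "ops A g (replicate (ar g) a) \<in> univ A" for g
    using algA a unfolding algebra_def by (simp add: set_replicate_conv_if)
  then have "(ops (sqalg A \<gamma>) g (replicate (ar g) (a, a)), (a, a)) \<in> \<Psi>" for g
    using diag a by (simp add: ops_sqalg)
  then have "((a, a), (a, b)) \<in> \<Psi>"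
    using semidegenerate_sqalg[OF \<gamma> \<Psi> Con_refl[OF \<gamma> a]] ab Con_refl[OF \<gamma> a] by blast
  then show "(a, b) \<in> \<delta>" using sat Con_refl[OF \<delta> a] by blast
qed

text \<open>The join of the two witnesses is a witness: it is reached by chains of
  \<open>\<Psi>\<close>- and \<open>\<Psi>'\<close>-steps, and each step keeps pairs inside
  \<open>\<delta>\<close>.\<close>

lemma central_cjoin:
  assumes \<beta>: "\<beta> \<in> Con ar A" and "central ar A \<alpha> \<beta> \<delta>" "central ar A \<alpha>' \<beta> \<delta>"
  shows "central ar A (cjoin ar A \<alpha> \<alpha>') \<beta> \<delta>"
proof -
  let ?P = "sqalg A \<beta>"
  obtain \<Psi> where \<Psi>: "\<Psi> \<in> Con ar ?P" "\<And>a b. (a, b) \<in> \<alpha> \<Longrightarrow> ((a, a), (b, b)) \<in> \<Psi>"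
    "\<And>p q. (p, q) \<in> \<Psi> \<Longrightarrow> p \<in> \<delta> \<Longrightarrow> q \<in> \<delta>"
    using assms(2) unfolding central_def by blast
  obtain \<Psi>' where \<Psi>': "\<Psi>' \<in> Con ar ?P" "\<And>a b. (a, b) \<in> \<alpha>' \<Longrightarrow> ((a, a), (b, b)) \<in> \<Psi>'"
    "\<And>p q. (p, q) \<in> \<Psi>' \<Longrightarrow> p \<in> \<delta> \<Longrightarrow> q \<in> \<delta>"
    using assms(3) unfolding central_def by blast
  let ?J = "cjoin ar ?P \<Psi> \<Psi>'"
  have J: "?J \<in> Con ar ?P" using cjoin_Con[OF alg_sqalg[OF \<beta>] \<Psi>(1) \<Psi>'(1)] .
  \<comment> \<open>The condition on diagonal pairs says that a relation lies in the pullback of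
    \<open>?J\<close> along the diagonal embedding. That pullback is a congruence, so checking
    \<open>\<alpha>\<close> and \<open>\<alpha>'\<close> suffices.\<close>
  have "cjoin ar A \<alpha> \<alpha>' \<subseteq> pull A (\<lambda>x. (x, x)) ?J"
  proof (rule cjoin_least)
    show "pull A (\<lambda>x. (x, x)) ?J \<in> Con ar A" using pull_Con[OF sqalg_hom(3)[OF \<beta>] J algA] .
    have "a \<in> univ A \<and> b \<in> univ A" if "((a, a), (b, b)) \<in> ?J" for a b
      using Con_univ[OF J that] Con_univ[OF \<beta>] by auto
    then have "(a, b) \<in> pull A (\<lambda>x. (x, x)) ?J" if "((a, a), (b, b)) \<in> ?J" for a b
      using that by (simp add: pull_def)
    then show "\<alpha> \<subseteq> pull A (\<lambda>x. (x, x)) ?J" "\<alpha>' \<subseteq> pull A (\<lambda>x. (x, x)) ?J"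
      using \<Psi>(2) \<Psi>'(2) cjoin_upper[of \<Psi> ar ?P \<Psi>'] cjoin_upper(2)[of \<Psi>' ar ?P \<Psi>] by (blast intro!: subrelI)+
  qed
  moreover have "q \<in> \<delta>" if "(p, q) \<in> ?J" "p \<in> \<delta>" for p q
  proof -
    have "(p, q) \<in> (\<Psi> O \<Psi>' O \<Psi>)\<^sup>+"
      using cjoin_subset_trancl[OF \<Psi>(1) \<Psi>'(1)] that(1) by blast
    then show ?thesis
    proof (induction rule: trancl_induct)
      case (base q)
      then show ?case using that(2) \<Psi>(3) \<Psi>'(3) by blast
    next
      case (step q r)
      then show ?case using \<Psi>(3) \<Psi>'(3) by blast
    qed
  qed
  ultimately show ?thesis
    using J unfolding central_def pull_def by blast
qed

text \<open>The witness is coordinatewise \<open>\<alpha>\<close>. If \<open>p\<close> lies in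
  \<open>\<alpha>\<close>, so does \<open>q\<close>, by the path
  \<open>fst q, fst p, snd p, snd q\<close>.\<close>

lemma central_Int:
  assumes \<alpha>: "\<alpha> \<in> Con ar A" and \<beta>: "\<beta> \<in> Con ar A"
  shows "central ar A \<alpha> \<beta> (\<alpha> \<inter> \<beta>)"
proof -
  let ?P = "sqalg A \<beta>"
  let ?\<Psi> = "pull ?P fst \<alpha> \<inter> pull ?P snd \<alpha>"
  have \<Psi>: "?\<Psi> \<in> Con ar ?P"
    using pull_Con[OF sqalg_hom(1)[OF \<beta>] \<alpha> alg_sqalg[OF \<beta>]]
      pull_Con[OF sqalg_hom(2)[OF \<beta>] \<alpha> alg_sqalg[OF \<beta>]] by (rule Con_Int)
  have diag: "((a, a), (b, b)) \<in> ?\<Psi>" if "(a, b) \<in> \<alpha>" for a b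
    using that Con_univ[OF \<alpha> that] Con_refl[OF \<beta>] by (auto simp: pull_def)
  have sat: "q \<in> \<alpha> \<inter> \<beta>" if "(p, q) \<in> ?\<Psi>" "p \<in> \<alpha> \<inter> \<beta>" for p q
  proof -
    have "(fst q, fst p) \<in> \<alpha>" "(fst p, snd p) \<in> \<alpha>" "(snd p, snd q) \<in> \<alpha>" "q \<in> \<beta>"
      using that Con_sym[OF \<alpha>] by (auto simp: pull_def)
    then have "(fst q, snd q) \<in> \<alpha>" using Con_trans[OF \<alpha>] by blast
    with \<open>q \<in> \<beta>\<close> show ?thesis by simp
  qed
  show ?thesis
    unfolding central_def using \<Psi> diag sat by blast
qed

text \<open>Transposing the \<open>2 \<times> 2\<close> matrices related by \<open>\<Psi>\<close> exchanges the roles of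
  \<open>\<alpha>\<close> and \<open>\<beta>\<close>. The shifting lemma, applied twice to the two projection kernels and
  \<open>\<Psi>\<close>, shows that the transposed relation still respects \<open>\<delta>\<close>, and even every
  larger \<open>\<delta>'\<close>.\<close>

lemma central_commute:
  assumes \<alpha>: "\<alpha> \<in> Con ar A" and \<beta>: "\<beta> \<in> Con ar A" and \<delta>: "\<delta> \<in> Con ar A" and \<delta>': "\<delta>' \<in> Con ar A"
    and "\<delta> \<subseteq> \<delta>'" and "central ar A \<alpha> \<beta> \<delta>"
  shows "central ar A \<beta> \<alpha> \<delta>'"
proof -
  let ?P = "sqalg A \<beta>"
  obtain \<Psi> where \<Psi>: "\<Psi> \<in> Con ar ?P" and diag: "\<And>a b. (a, b) \<in> \<alpha> \<Longrightarrow> ((a, a), (b, b)) \<in> \<Psi>"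
    and sat: "\<And>p q. (p, q) \<in> \<Psi> \<Longrightarrow> p \<in> \<delta> \<Longrightarrow> q \<in> \<delta>"
    using assms(6) unfolding central_def by blast
  let ?\<eta>0 = "pull ?P fst (Delta A)" and ?\<eta>1 = "pull ?P snd (Delta A)"
  have \<eta>: "?\<eta>0 \<in> Con ar ?P" "?\<eta>1 \<in> Con ar ?P" "pull ?P snd \<delta>' \<in> Con ar ?P"
    using pull_Con[OF sqalg_hom(1)[OF \<beta>] _ alg_sqalg[OF \<beta>]] Delta_Con[OF algA]
      pull_Con[OF sqalg_hom(2)[OF \<beta>] _ alg_sqalg[OF \<beta>]] \<delta>' by blast+
  have \<eta>0_iff: "((a, b), (c, d)) \<in> ?\<eta>0 \<longleftrightarrow> (a, b) \<in> \<beta> \<and> (c, d) \<in> \<beta> \<and> a = c" for a b c d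
    using Con_univ[OF \<beta>] by (auto simp: pull_def Delta_def)
  have \<eta>1_iff: "((a, b), (c, d)) \<in> ?\<eta>1 \<longleftrightarrow> (a, b) \<in> \<beta> \<and> (c, d) \<in> \<beta> \<and> b = d" for a b c d
    using Con_univ[OF \<beta>] by (auto simp: pull_def Delta_def)
  \<comment> \<open>In the square \<open>(y, y), (x, y), (y, z), (x, z)\<close> the shifting lemma
    replaces the common first coordinate \<open>x\<close> by \<open>y\<close>. The resulting pair
    starts on the diagonal, so \<open>sat\<close> applies.\<close>
  have vertical: "(y, z) \<in> \<delta>" if xyz: "((x, y), (x, z)) \<in> \<Psi>" for x y z
  proof -
    have \<beta>s: "(x, y) \<in> \<beta>" "(x, z) \<in> \<beta>" using Con_univ[OF \<Psi> xyz] by auto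
    then have yz: "(y, y) \<in> \<beta>" "(y, z) \<in> \<beta>"
      using Con_trans[OF \<beta> Con_sym[OF \<beta> \<beta>s(1)]] by simp_all
    have "((y, y), (y, z)) \<in> \<Psi>"
    proof (rule shifting_sqalg[OF \<beta> \<eta>(2,1) \<Psi>])
      show "?\<eta>1 \<inter> ?\<eta>0 \<subseteq> \<Psi>"
      proof clarify
        fix a b c d assume "((a, b), (c, d)) \<in> ?\<eta>1" "((a, b), (c, d)) \<in> ?\<eta>0"
        then show "((a, b), (c, d)) \<in> \<Psi>"
          unfolding \<eta>0_iff \<eta>1_iff using Con_refl[OF \<Psi>, of "(a, b)"] by simp
      qed
      show "((y, y), (x, y)) \<in> ?\<eta>1" "((y, z), (x, z)) \<in> ?\<eta>1"
        "((y, y), (y, z)) \<in> ?\<eta>0" "((x, y), (x, z)) \<in> ?\<eta>0"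
        using \<beta>s yz by (simp_all add: \<eta>0_iff \<eta>1_iff)
    qed (rule xyz)
    moreover have "(y, y) \<in> \<delta>" using Con_refl[OF \<delta>] Con_univ[OF \<beta> yz(1)] by blast
    ultimately show ?thesis using sat by blast
  qed
  \<comment> \<open>Second shift, with \<open>?\<eta>0\<close> and \<open>\<Psi>\<close> as the
    sides of the square and \<open>\<delta>'\<close> on second coordinates as the third congruence.
    By \<open>vertical\<close>, \<open>?\<eta>0 \<inter> \<Psi>\<close> forces second coordinates to
    be related by \<open>\<delta>\<close>, hence by \<open>\<delta>'\<close>.\<close>
  have shift: "(c, d) \<in> \<delta>'" if "((c, a), (d, b)) \<in> \<Psi>" "(c, d) \<in> \<alpha>" "(a, b) \<in> \<delta>'" for a b c d
  proof -
    have \<beta>s: "(c, a) \<in> \<beta>" "(d, b) \<in> \<beta>" using Con_univ[OF \<Psi> that(1)] by auto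
    then have cd: "(c, c) \<in> \<beta>" "(d, d) \<in> \<beta>"
      using Con_refl[OF \<beta>] Con_univ[OF \<beta> \<beta>s(1)] Con_univ[OF \<beta> \<beta>s(2)] by simp_all
    have "((c, c), (d, d)) \<in> pull ?P snd \<delta>'"
    proof (rule shifting_sqalg[OF \<beta> \<eta>(1) \<Psi> \<eta>(3)])
      show "?\<eta>0 \<inter> \<Psi> \<subseteq> pull ?P snd \<delta>'"
      proof clarify
        fix x y x' z assume "((x, y), (x', z)) \<in> ?\<eta>0" and *: "((x, y), (x', z)) \<in> \<Psi>"
        then have "x' = x" by (simp add: \<eta>0_iff)
        with * have "(y, z) \<in> \<delta>" by (simp add: vertical)
        then have "(y, z) \<in> \<delta>'" using assms(5) by (rule rev_subsetD)
        then show "((x, y), (x', z)) \<in> pull ?P snd \<delta>'"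
          using Con_univ[OF \<Psi> *] by (simp add: pull_def)
      qed
      show "((c, c), (c, a)) \<in> ?\<eta>0" "((d, d), (d, b)) \<in> ?\<eta>0"
        using \<beta>s cd by (simp_all add: \<eta>0_iff)
      show "((c, c), (d, d)) \<in> \<Psi>" using diag that(2) .
      show "((c, a), (d, b)) \<in> \<Psi>" using that(1) .
      show "((c, a), (d, b)) \<in> pull ?P snd \<delta>'" using that(3) \<beta>s by (simp add: pull_def)
    qed
    then show ?thesis by (simp add: pull_def)
  qed
  \<comment> \<open>\<open>p\<close> and \<open>q\<close> are read as the columns of a matrix whose
    rows are pairs of \<open>\<beta>\<close>. The second membership in \<open>\<Psi>\<close> swaps
    the columns and makes \<open>T\<close> symmetric; transitivity comes from
    \<open>T\<^sup>+\<close>.\<close>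
  define T where "T = {(p, q). p \<in> \<alpha> \<and> q \<in> \<alpha> \<and>
    ((fst q, fst p), (snd q, snd p)) \<in> \<Psi> \<and> ((fst p, fst q), (snd p, snd q)) \<in> \<Psi>}"
  have "T\<^sup>+ \<in> Con ar (sqalg A \<alpha>)"
  proof (rule trancl_Con)
    show "T \<subseteq> univ (sqalg A \<alpha>) \<times> univ (sqalg A \<alpha>)" by (auto simp: T_def)
    show "(p, p) \<in> T" if "p \<in> univ (sqalg A \<alpha>)" for p
      using that diag by (cases p) (simp add: T_def)
    show "(q, p) \<in> T" if "(p, q) \<in> T" for p q
      using that by (simp add: T_def)
    fix g ps qs
    assume len: "length ps = ar g" and l: "list_all2 (\<lambda>p q. (p, q) \<in> T) ps qs"
    then have len': "length qs = ar g" by (simp add: list_all2_lengthD)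
    have sub: "set ps \<subseteq> \<alpha>" "set qs \<subseteq> \<alpha>"
      using list_all2_rel_set[OF l, of \<alpha>] by (auto simp: T_def)
    have mem: "ops (sqalg A \<alpha>) g ps \<in> \<alpha>" "ops (sqalg A \<alpha>) g qs \<in> \<alpha>"
      using alg_sqalg[OF \<alpha>] len len' sub by (auto simp: algebra_def)
    \<comment> \<open>Zipping regroups the entries of \<open>ps\<close> and \<open>qs\<close> into
      pairs of \<open>\<beta>\<close>, so that the compatibility of \<open>\<Psi>\<close> becomes
      applicable.\<close>
    have "list_all2 (\<lambda>p q. (p, q) \<in> \<Psi>) (zip (map fst qs) (map fst ps)) (zip (map snd qs) (map snd ps))"
      "list_all2 (\<lambda>p q. (p, q) \<in> \<Psi>) (zip (map fst ps) (map fst qs)) (zip (map snd ps) (map snd qs))"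
      using l by (auto simp: T_def list_all2_conv_all_nth)
    then have "(ops ?P g (zip (map fst qs) (map fst ps)), ops ?P g (zip (map snd qs) (map snd ps))) \<in> \<Psi>"
      "(ops ?P g (zip (map fst ps) (map fst qs)), ops ?P g (zip (map snd ps) (map snd qs))) \<in> \<Psi>"
      using Con_compat[OF \<Psi>] len len' by simp_all
    then show "(ops (sqalg A \<alpha>) g ps, ops (sqalg A \<alpha>) g qs) \<in> T"
      using mem len len' by (simp add: T_def ops_sqalg)
  qed
  moreover have "((a, a), (b, b)) \<in> T\<^sup>+" if "(a, b) \<in> \<beta>" for a b
  proof -
    have "a \<in> univ A" "b \<in> univ A" using Con_univ[OF \<beta> that] by auto
    then have "((a, a), (b, b)) \<in> T"
      using Con_refl[OF \<alpha>] Con_refl[OF \<Psi>] that Con_sym[OF \<beta> that] by (simp add: T_def)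
    then show ?thesis by blast
  qed
  moreover have "q \<in> \<delta>'" if "(p, q) \<in> T\<^sup>+" "p \<in> \<delta>'" for p q
  proof -
    have T: "q \<in> \<delta>'" if "(p, q) \<in> T" "p \<in> \<delta>'" for p q
      using that shift[of "fst q" "fst p" "snd q" "snd p"] by (simp add: T_def)
    show ?thesis
      using that(1)
    proof (induction rule: trancl_induct)
      case (base q)
      then show ?case using T that(2) by blast
    next
      case (step q r)
      then show ?case using T by blast
    qed
  qed
  ultimately show ?thesis unfolding central_def by blast
qed

text \<open>\<open>central_Int\<close> for the reversed pair gives the modulus
  \<open>\<beta> \<inter> \<alpha>\<close>; \<open>central_commute\<close> restores the order and
  enlarges the modulus to \<open>\<delta>\<close> at once.\<close>

lemma central_if_Int_subset:
  assumes "\<alpha> \<in> Con ar A" "\<beta> \<in> Con ar A" "\<delta> \<in> Con ar A" "\<alpha> \<inter> \<beta> \<subseteq> \<delta>"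
  shows "central ar A \<alpha> \<beta> \<delta>"
  using central_commute[OF assms(2,1) Con_Int[OF assms(2,1)] assms(3)] assms(4) central_Int[OF assms(2,1)]
  by blast

section \<open>Complemented congruences\<close>

text \<open>Both \<open>\<alpha>\<close> and \<open>\<beta>\<close> centralize
  \<open>\<gamma>\<close> modulo \<open>\<delta>\<close>, so their join \<open>Nabla A\<close> does
  too. This is the distributivity \<open>\<gamma> = (\<gamma> \<inter> \<alpha>) \<or> (\<gamma>
  \<inter> \<beta>)\<close>, phrased through an arbitrary upper bound
  \<open>\<delta>\<close>.\<close>

lemma subset_if_Int_subset:
  assumes "\<alpha> \<in> Con ar A" "\<beta> \<in> Con ar A" "\<gamma> \<in> Con ar A" "\<delta> \<in> Con ar A"
    and "cjoin ar A \<alpha> \<beta> = Nabla A" "\<alpha> \<inter> \<gamma> \<subseteq> \<delta>" "\<beta> \<inter> \<gamma> \<subseteq> \<delta>"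
  shows "\<gamma> \<subseteq> \<delta>"
  using central_cjoin[of \<gamma> \<alpha> \<delta> \<beta>] central_if_Int_subset assms central_Nabla by metis

text \<open>The intersection lies below both congruences, so by symmetry each of them centralizes it
  modulo \<open>Delta A\<close>. Hence so does their join \<open>Nabla A\<close>, and
  \<open>central_Nabla\<close> applies.\<close>

lemma central_complement:
  assumes \<alpha>: "\<alpha> \<in> Con ar A" and \<beta>: "\<beta> \<in> Con ar A"
    and "cjoin ar A \<alpha> \<beta> = Nabla A" and cen: "central ar A \<alpha> \<beta> (Delta A)"
  shows "\<alpha> \<inter> \<beta> = Delta A"
proof -
  note \<gamma> = Con_Int[OF \<alpha> \<beta>] and \<Delta> = Delta_Con[OF algA]
  have "central ar A \<beta> \<alpha> (Delta A)"
    using central_commute[OF \<alpha> \<beta> \<Delta> \<Delta> _ cen] by simp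
  then have "central ar A \<alpha> (\<alpha> \<inter> \<beta>) (Delta A)"
    using central_commute[OF \<gamma> \<alpha> \<Delta> \<Delta>] central_antimono by blast
  moreover have "central ar A \<beta> (\<alpha> \<inter> \<beta>) (Delta A)"
    using central_commute[OF \<gamma> \<beta> \<Delta> \<Delta>] central_antimono cen by blast
  ultimately have "\<alpha> \<inter> \<beta> \<subseteq> Delta A"
    using central_cjoin[OF \<gamma>] central_Nabla[OF \<gamma> \<Delta>] assms(3) by metis
  then show ?thesis using Delta_least[OF \<gamma>] by blast
qed

text \<open>De Morgan's law for complements. The join is treated first, since
  \<open>central_complement\<close> needs it for the meet.\<close>

lemma complement_Int:
  assumes Con: "\<alpha> \<in> Con ar A" "\<alpha>' \<in> Con ar A" "\<beta> \<in> Con ar A" "\<beta>' \<in> Con ar A"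
    and \<alpha>: "\<alpha> \<inter> \<alpha>' = Delta A" "cjoin ar A \<alpha> \<alpha>' = Nabla A"
    and \<beta>: "\<beta> \<inter> \<beta>' = Delta A" "cjoin ar A \<beta> \<beta>' = Nabla A"
  shows "(\<alpha> \<inter> \<beta>) \<inter> cjoin ar A \<alpha>' \<beta>' = Delta A"
    and "cjoin ar A (\<alpha> \<inter> \<beta>) (cjoin ar A \<alpha>' \<beta>') = Nabla A"
proof -
  let ?\<sigma> = "cjoin ar A \<alpha>' \<beta>'"
  note \<Delta> = Delta_Con[OF algA] and I = Con_Int[OF Con(1,3)]
  have \<sigma>: "?\<sigma> \<in> Con ar A" using cjoin_Con[OF algA Con(2,4)] .
  have J: "cjoin ar A (\<alpha> \<inter> \<beta>) ?\<sigma> \<in> Con ar A" (is "?J \<in> _") using cjoin_Con[OF algA I \<sigma>] .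
  have up: "\<alpha> \<inter> \<beta> \<subseteq> ?J" "\<alpha>' \<subseteq> ?J" "\<beta>' \<subseteq> ?J"
    using cjoin_upper[of "\<alpha> \<inter> \<beta>" ar A ?\<sigma>] cjoin_upper(2)[of ?\<sigma> ar A "\<alpha> \<inter> \<beta>"]
      cjoin_upper(1)[of \<alpha>' ar A \<beta>'] cjoin_upper(2)[of \<beta>' ar A \<alpha>'] by blast+
  \<comment> \<open>\<open>\<alpha> \<inter> \<beta>\<close> and
    \<open>\<alpha> \<inter> \<beta>'\<close> both lie below \<open>?J\<close>, and
    \<open>\<beta>\<close>, \<open>\<beta>'\<close> join to \<open>Nabla A\<close>.\<close>
  have "\<alpha> \<subseteq> ?J"
    using subset_if_Int_subset[OF Con(3,4,1) J \<beta>(2)] up by blast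
  then have "cjoin ar A \<alpha> \<alpha>' \<subseteq> ?J" using cjoin_least[OF J _ up(2)] by blast
  then show join: "?J = Nabla A" using \<alpha>(2) Nabla_greatest[OF J] by blast
  \<comment> \<open>The meet with a join is not directly accessible, but centrality modulo
    \<open>Delta A\<close> passes from \<open>\<alpha>'\<close> and \<open>\<beta>'\<close> to their
    join.\<close>
  have "central ar A \<alpha>' (\<alpha> \<inter> \<beta>) (Delta A)" "central ar A \<beta>' (\<alpha> \<inter> \<beta>) (Delta A)"
    using central_if_Int_subset[OF _ I \<Delta>] Con(2,4) \<alpha>(1) \<beta>(1) by blast+
  then have "central ar A ?\<sigma> (\<alpha> \<inter> \<beta>) (Delta A)" by (rule central_cjoin[OF I])
  then show "(\<alpha> \<inter> \<beta>) \<inter> ?\<sigma> = Delta A"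
    using central_complement[OF \<sigma> I] join cjoin_commute by (metis Int_commute)
qed

lemma BCon_Int_complement:
  assumes "\<alpha> \<in> BCon ar A" "\<beta> \<in> Con ar A" "\<beta>' \<in> Con ar A"
    and "\<beta> \<inter> \<beta>' = Delta A" "cjoin ar A \<beta> \<beta>' = Nabla A"
  shows "\<alpha> \<inter> \<beta>' \<in> BCon ar A"
proof -
  obtain \<alpha>' where \<alpha>: "\<alpha> \<in> Con ar A" "\<alpha>' \<in> Con ar A" "\<alpha> \<inter> \<alpha>' = Delta A" "cjoin ar A \<alpha> \<alpha>' = Nabla A"
    using assms(1) unfolding BCon_def by blast
  have \<beta>: "\<beta>' \<inter> \<beta> = Delta A" "cjoin ar A \<beta>' \<beta> = Nabla A"
    using assms(4,5) cjoin_commute by (metis Int_commute)+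
  show ?thesis
    unfolding BCon_def
    using complement_Int[OF \<alpha>(1,2) assms(3,2) \<alpha>(3,4) \<beta>] Con_Int[OF \<alpha>(1) assms(3)]
      cjoin_Con[OF algA \<alpha>(2) assms(2)] by blast
qed

end

section \<open>The map \<open>u\<^sup>\<bullet>\<close> and its adjoint\<close>

lemma ubul_Con:
  assumes "hom ar u A A'" "algebra ar A'" "\<alpha> \<in> Con ar A"
  shows "ubul ar u A' \<alpha> \<in> Con ar A'"
  unfolding ubul_def
  using assms Con_subset[OF assms(3)] by (intro Cg_Con) (auto simp: hom_def)

lemma ubul_mono: "\<alpha> \<subseteq> \<beta> \<Longrightarrow> ubul ar u A' \<alpha> \<subseteq> ubul ar u A' \<beta>"
  unfolding ubul_def by (intro Cg_mono image_mono)

text \<open>\<open>u\<^sup>\<bullet>\<close> is left adjoint to pulling back along \<open>u\<close>;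
  the preservation of joins is used in this form.\<close>

lemma ubul_subset_iff:
  assumes "\<alpha> \<in> Con ar A" "\<theta> \<in> Con ar A'"
  shows "ubul ar u A' \<alpha> \<subseteq> \<theta> \<longleftrightarrow> \<alpha> \<subseteq> pull A u \<theta>"
proof
  assume "ubul ar u A' \<alpha> \<subseteq> \<theta>"
  then have "(\<lambda>(a, b). (u a, u b)) ` \<alpha> \<subseteq> \<theta>"
    using Cg_upper unfolding ubul_def by blast
  then show "\<alpha> \<subseteq> pull A u \<theta>"
    using Con_subset[OF assms(1)] by (auto simp: pull_def)
next
  assume "\<alpha> \<subseteq> pull A u \<theta>"
  then show "ubul ar u A' \<alpha> \<subseteq> \<theta>"
    unfolding ubul_def by (intro Cg_least[OF assms(2)]) (auto simp: pull_def)
qed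

text \<open>With \<open>?\<theta>\<close> the image of \<open>\<alpha> \<inter> \<beta>'\<close>,
  the part \<open>\<alpha> \<inter> \<beta>\<close> has image below \<open>Delta A'\<close>. So both
  parts of \<open>\<alpha>\<close> lie in the pullback of \<open>?\<theta>\<close>, and by
  distributivity so does \<open>\<alpha>\<close>.\<close>

lemma (in modular_semidegenerate) ubul_Int_complement:
  assumes A': "algebra ar A'" and u: "hom ar u A A'"
    and \<alpha>: "\<alpha> \<in> Con ar A" and \<beta>: "\<beta> \<in> Con ar A" and \<beta>': "\<beta>' \<in> Con ar A"
    and join: "cjoin ar A \<beta> \<beta>' = Nabla A"
    and orth: "ubul ar u A' \<alpha> \<inter> ubul ar u A' \<beta> = Delta A'"
  shows "ubul ar u A' (\<alpha> \<inter> \<beta>') = ubul ar u A' \<alpha>"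
proof
  show "ubul ar u A' (\<alpha> \<inter> \<beta>') \<subseteq> ubul ar u A' \<alpha>" by (rule ubul_mono) simp
  let ?\<theta> = "ubul ar u A' (\<alpha> \<inter> \<beta>')"
  have \<theta>: "?\<theta> \<in> Con ar A'" using ubul_Con[OF u A' Con_Int[OF \<alpha> \<beta>']] .
  have "ubul ar u A' (\<alpha> \<inter> \<beta>) \<subseteq> Delta A'"
    using ubul_mono[of "\<alpha> \<inter> \<beta>" \<alpha> ar u A'] ubul_mono[of "\<alpha> \<inter> \<beta>" \<beta> ar u A'] orth by blast
  then have "\<alpha> \<inter> \<beta> \<subseteq> pull A u ?\<theta>"
    using ubul_subset_iff[OF Con_Int[OF \<alpha> \<beta>] \<theta>] Delta_least[OF \<theta>] by blast
  moreover have "\<alpha> \<inter> \<beta>' \<subseteq> pull A u ?\<theta>"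
    using ubul_subset_iff[OF Con_Int[OF \<alpha> \<beta>'] \<theta>] by blast
  ultimately have "\<alpha> \<subseteq> pull A u ?\<theta>"
    using subset_if_Int_subset[OF \<beta> \<beta>' \<alpha> pull_Con[OF u \<theta> algA] join] by blast
  then show "ubul ar u A' \<alpha> \<subseteq> ?\<theta>"
    using ubul_subset_iff[OF \<alpha> \<theta>] by blast
qed

section \<open>Making the lifts orthogonal\<close>

lemma BCon_Con: "\<alpha> \<in> BCon ar A \<Longrightarrow> \<alpha> \<in> Con ar A"
  by (simp add: BCon_def)

theorem theorem7p1:
  fixes ar :: "'f \<Rightarrow> nat"
    and Sig :: "(('f, nat) trm \<times> ('f, nat) trm) set"
    and A :: "('a, 'f) alg" and A' :: "('b, 'f) alg"
    and u :: "'a \<Rightarrow> 'b"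
    and \<Omega>' :: "('b \<times> 'b) set set"
  assumes "finite (UNIV :: 'f set)"
    and "wf_ids ar Sig"
    and "infinite (UNIV :: 'a set)" and "infinite (UNIV :: 'b set)"
    and "var_hyps ar Sig TYPE('a)" and "var_hyps ar Sig TYPE('b)"
    and "in_var ar Sig A" and "in_var ar Sig A'"
    and "hom ar u A A'"
    and "lifts_boolean ar u A A'"
    and "countable \<Omega>'" and "orthogonal ar A' \<Omega>'"
  shows "\<exists>\<Omega>. countable \<Omega> \<and> orthogonal ar A \<Omega> \<and> lifts ar u A' \<Omega>' \<Omega>"
proof -
  interpret modular_semidegenerate ar Sig A
    using assms(2,3,5,7) by (simp add: modular_semidegenerate_def var_hyps_def)
  have A': "algebra ar A'" using assms(8) by (simp add: in_var_def)
  note u = assms(9)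
  have "\<forall>\<omega>\<in>\<Omega>'. \<exists>x. x \<in> BCon ar A \<and> ubul ar u A' x = \<omega>"
  proof
    fix \<omega> assume "\<omega> \<in> \<Omega>'"
    then have "\<omega> \<in> ubul ar u A' ` BCon ar A"
      using assms(10,12) by (auto simp: lifts_boolean_def lifts_def orthogonal_def)
    then show "\<exists>x. x \<in> BCon ar A \<and> ubul ar u A' x = \<omega>" by auto
  qed
  from bchoice[OF this] obtain x
    where "\<forall>\<omega>\<in>\<Omega>'. x \<omega> \<in> BCon ar A \<and> ubul ar u A' (x \<omega>) = \<omega>" ..
  then have x: "x \<omega> \<in> BCon ar A" and ux: "ubul ar u A' (x \<omega>) = \<omega>" if "\<omega> \<in> \<Omega>'" for \<omega>
    using that by simp_all
  have "\<forall>\<omega>\<in>\<Omega>'. \<exists>x'. x' \<in> Con ar A \<and> x \<omega> \<inter> x' = Delta A \<and> cjoin ar A (x \<omega>) x' = Nabla A"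
    using x by (simp add: BCon_def Bex_def)
  from bchoice[OF this] obtain x' where
    "\<forall>\<omega>\<in>\<Omega>'. x' \<omega> \<in> Con ar A \<and> x \<omega> \<inter> x' \<omega> = Delta A \<and> cjoin ar A (x \<omega>) (x' \<omega>) = Nabla A" ..
  then have x': "x' \<omega> \<in> Con ar A"
    and compl: "x \<omega> \<inter> x' \<omega> = Delta A" "cjoin ar A (x \<omega>) (x' \<omega>) = Nabla A"
    if "\<omega> \<in> \<Omega>'" for \<omega>
    using that by simp_all
  have orth: "\<omega> \<inter> \<eta> = Delta A'" if "\<omega> \<in> \<Omega>'" "\<eta> \<in> \<Omega>'" "\<omega> \<noteq> \<eta>" for \<omega> \<eta>
    using assms(12) that unfolding orthogonal_def by blast
  \<comment> \<open>One complement is cut off at a time. The image stays \<open>\<omega>\<close>,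
    hence orthogonal to the next \<open>\<eta>\<close>, so \<open>ubul_Int_complement\<close>
    applies again. For empty \<open>G\<close> the intersection is \<open>UNIV\<close> and
    \<open>x \<omega>\<close> itself remains.\<close>
  have meet: "x \<omega> \<inter> \<Inter>(x' ` G) \<in> BCon ar A \<and> ubul ar u A' (x \<omega> \<inter> \<Inter>(x' ` G)) = \<omega>"
    if "\<omega> \<in> \<Omega>'" "finite G" "G \<subseteq> \<Omega>' - {\<omega>}" for \<omega> G
    using that(2,3)
  proof (induction G rule: finite_induct)
    case empty
    then show ?case using x ux that(1) by simp
  next
    case (insert \<eta> G)
    let ?y = "x \<omega> \<inter> \<Inter>(x' ` G)"
    have \<eta>: "\<eta> \<in> \<Omega>'" "\<omega> \<noteq> \<eta>" using insert.prems by auto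
    have y: "?y \<in> BCon ar A" "ubul ar u A' ?y = \<omega>" using insert.IH insert.prems by auto
    have eq: "x \<omega> \<inter> \<Inter>(x' ` insert \<eta> G) = ?y \<inter> x' \<eta>" by auto
    have "ubul ar u A' (?y \<inter> x' \<eta>) = ubul ar u A' ?y"
      using ubul_Int_complement[OF A' u BCon_Con[OF y(1)] BCon_Con[OF x[OF \<eta>(1)]] x'[OF \<eta>(1)]
          compl(2)[OF \<eta>(1)]] y(2) ux[OF \<eta>(1)] orth[OF that(1) \<eta>] by simp
    moreover have "?y \<inter> x' \<eta> \<in> BCon ar A"
      using BCon_Int_complement[OF y(1) BCon_Con[OF x[OF \<eta>(1)]] x'[OF \<eta>(1)] compl[OF \<eta>(1)]] .
    ultimately show ?case using y(2) unfolding eq by simp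
  qed
  let ?n = "to_nat_on \<Omega>'"
  \<comment> \<open>The earlier members of the enumeration: finitely many, because \<open>?n\<close>
    is injective on \<open>\<Omega>'\<close> and their numbers lie below
    \<open>?n \<omega>\<close>.\<close>
  define G where "G \<omega> = {\<eta> \<in> \<Omega>'. ?n \<eta> < ?n \<omega>}" for \<omega>
  have inj: "inj_on ?n \<Omega>'" using assms(11) by (rule inj_on_to_nat_on)
  have G: "finite (G \<omega>)" "G \<omega> \<subseteq> \<Omega>' - {\<omega>}" for \<omega>
  proof -
    have "?n ` G \<omega> \<subseteq> {..<?n \<omega>}" by (auto simp: G_def)
    moreover have "inj_on ?n (G \<omega>)"
      using inj by (rule inj_on_subset) (auto simp: G_def)
    ultimately show "finite (G \<omega>)"
      using finite_imageD finite_subset[OF _ finite_lessThan] by blast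
  qed (auto simp: G_def)
  define y where "y \<omega> = x \<omega> \<inter> \<Inter>(x' ` G \<omega>)" for \<omega>
  have y: "y \<omega> \<in> BCon ar A" "ubul ar u A' (y \<omega>) = \<omega>" if "\<omega> \<in> \<Omega>'" for \<omega>
    using meet[OF that G] unfolding y_def by auto
  have less: "y \<omega> \<inter> y \<eta> = Delta A" if "\<omega> \<in> \<Omega>'" "\<eta> \<in> \<Omega>'" "?n \<omega> < ?n \<eta>" for \<omega> \<eta>
  proof -
    \<comment> \<open>The earlier \<open>\<omega>\<close> belongs to \<open>G \<eta>\<close>, so
      \<open>y \<eta>\<close> was cut by \<open>x' \<omega>\<close>, while \<open>y \<omega>\<close>
      lies below \<open>x \<omega>\<close>.\<close>
    have "y \<omega> \<inter> y \<eta> \<subseteq> x \<omega> \<inter> x' \<omega>" using that by (auto simp: y_def G_def)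
    then show ?thesis
      using compl(1)[OF that(1)] Delta_least[OF Con_Int[OF BCon_Con[OF y(1)[OF that(1)]] BCon_Con[OF y(1)[OF that(2)]]]]
      by blast
  qed
  have "y \<omega> \<inter> y \<eta> = Delta A" if "\<omega> \<in> \<Omega>'" "\<eta> \<in> \<Omega>'" "\<omega> \<noteq> \<eta>" for \<omega> \<eta>
  proof -
    have "?n \<omega> \<noteq> ?n \<eta>" using inj that by (auto dest: inj_onD)
    then consider "?n \<omega> < ?n \<eta>" | "?n \<eta> < ?n \<omega>" by linarith
    then show ?thesis
      using less[OF that(1,2)] less[OF that(2,1)] by cases (simp_all add: Int_commute)
  qed
  then have "orthogonal ar A (y ` \<Omega>')"
    using y(1) unfolding orthogonal_def by blast
  moreover have "lifts ar u A' \<Omega>' (y ` \<Omega>')"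
    using y(2) by (simp add: lifts_def image_image)
  ultimately show ?thesis using assms(11) by blast
qed

end
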